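(* Let $\{X_n\}_{n\ge 0}$ be a two-type branching process with immigration (with the notation fixed in the context) such that $f(\mathbf 0)=\mathbf 0$ and the mean matrix $M=(m_{ij})$ is positively regular. Let $\boldsymbol u$ be the right eigenvector of $M$ corresponding to its maximal eigenvalue $\rho$, with $\rho>1$, and let $E(I_n)=\boldsymbol\lambda=(\lambda_1,\lambda_2)$. Assume that $\lambda_i<\infty$ and $m_{ij}<\infty$ for $i,j=1,2$. Define $\mathcal F_n=\sigma(X_0,\dots,X_n)$ and $$Y_n=\rho^{-n}\Big[\boldsymbol u\cdot X_n-\frac{\rho^{n+1}-1}{\rho-1}(\boldsymbol u\cdot\boldsymbol\lambda)\Big].$$ Then, under $P_i$ for $i=1,2$, $\{(Y_n,\mathcal F_n);\ n\ge0\}$ is a martingale and $Y_n$ converges to a random variable $Y$ with probability 1 as $n\to\infty$.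
   Context: $\mathbb N=\{0,1,2,\dots\}$, $\mathbf 1=(1,1)$, $\mathbf 0=(0,0)$, $e_1=(1,0)$, $e_2=(0,1)$; vectors are row vectors and $\cdot$ is the Euclidean inner product. $\{Z_n\}_{n\ge0}$ is a two-type Galton–Watson branching process: each particle of type $i$ independently produces, in the next generation, a random vector of offspring with law $P_i(j_1,j_2)=P(Z_1=(j_1,j_2)\mid Z_0=e_i)$. Its offspring generating functions are $f^{(i)}(\boldsymbol s)=\sum_{\boldsymbol j\in\mathbb N^2}P_i(j_1,j_2)s_1^{j_1}s_2^{j_2}$, and $f=(f^{(1)},f^{(2)})$. $I_1,I_2,\dots$ are i.i.d. $\mathbb N^2$-valued immigration vectors, independent of the reproduction. The process with immigration is $X_0=Z_0$, $X_n=Z_n+U_n^{(1)}+\cdots+U_n^{(n)}$ for $n\ge1$, where $U_n^{(k)}$ is the vector of numbers of descendants, in generation $n$, of the $k$-th immigration $I_k$ (so $U_n^{(n)}=I_n$); all particles reproduce independently with the same offspring laws. Equivalently, given $X_n=\boldsymbol j$, $X_{n+1}$ is the sum of the offspring vectors of the $j_1$ particles of type 1 and the $j_2$ particles of type 2 plus the independent vector $I_{n+1}$. $P_i$ and $E_i$ denote probability and expectation given $X_0=e_i$. $m_{ij}=\partial f^{(i)}/\partial s_j(\mathbf 1^-)$ is the expected number of type-$j$ offspring of a type-$i$ particle. Positively regular means that some power of $M$ has all entries strictly positive; $\rho$ is then the maximal (Perron–Frobenius) eigenvalue of $M$, and $\boldsymbol u$ is strictly positive with $M\boldsymbol u^\top=\rho\boldsymbol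 u^\top$ and $\boldsymbol u\cdot\mathbf 1=1$. *)

theory Defs
  imports "HOL-Probability.Probability"
begin

text \<open>Particle types are the two elements \<open>1\<close> and \<open>2\<close> of the numeral type \<open>2\<close>; a population is a
  vector of type \<open>nat ^ 2\<close>, and \<open>axis i 1\<close> is the unit vector \<open>e\<^sub>i\<close>.\<close>

definition real_vec :: "nat ^ 2 \<Rightarrow> real ^ 2" where
  "real_vec x = (\<chi> a. real (x $ a))"


subsection \<open>Offspring laws, generating functions and the mean matrix\<close>

definition offspring_gf :: "(2 \<Rightarrow> (nat ^ 2) pmf) \<Rightarrow> real ^ 2 \<Rightarrow> real ^ 2" where
  "offspring_gf P s = (\<chi> i. \<Sum>\<^sub>\<infinity>x. pmf (P i) x * (s $ 1 ^ (x $ 1) * s $ 2 ^ (x $ 2)))"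

definition offspring_gf_partial :: "(2 \<Rightarrow> (nat ^ 2) pmf) \<Rightarrow> 2 \<Rightarrow> 2 \<Rightarrow> real ^ 2 \<Rightarrow> real" where
  "offspring_gf_partial P i j s =
     deriv (\<lambda>t. offspring_gf P (\<chi> a. if a = j then t else s $ a) $ i) (s $ j)"

text \<open>The value of the partial derivative at \<open>(1-, 1-)\<close>.  The partial derivatives are nonnegative and
  nondecreasing in each coordinate on \<open>[0,1)\<^sup>2\<close>, so the limit always exists in \<open>[0, \<infinity>]\<close>; it is the
  expected number of type-\<open>j\<close> offspring of a type-\<open>i\<close> particle, possibly infinite.\<close>

definition offspring_mean :: "(2 \<Rightarrow> (nat ^ 2) pmf) \<Rightarrow> 2 \<Rightarrow> 2 \<Rightarrow> ereal" where
  "offspring_mean P i j =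
     Lim (at 1 within {s. \<forall>a. 0 \<le> s $ a \<and> s $ a < 1}) (\<lambda>s. ereal (offspring_gf_partial P i j s))"

definition mean_matrix :: "(2 \<Rightarrow> (nat ^ 2) pmf) \<Rightarrow> real ^ 2 ^ 2" where
  "mean_matrix P = (\<chi> i j. real_of_ereal (offspring_mean P i j))"

text \<open>Powers are iterated matrix products; the type-class power \<open>A ^ k\<close> on \<open>real ^ 2 ^ 2\<close> would be
  taken entrywise.\<close>

definition positively_regular :: "real ^ 2 ^ 2 \<Rightarrow> bool" where
  "positively_regular A \<longleftrightarrow> (\<exists>k. \<forall>i j. 0 < (((**) A ^^ k) (mat 1)) $ i $ j)"

definition complex_eigenvalue :: "real ^ 2 ^ 2 \<Rightarrow> complex \<Rightarrow> bool" where
  "complex_eigenvalue A z \<longleftrightarrow>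
     (\<exists>v :: complex ^ 2. v \<noteq> 0 \<and> map_matrix complex_of_real A *v v = z *s v)"

definition maximal_eigenvalue :: "real ^ 2 ^ 2 \<Rightarrow> real \<Rightarrow> bool" where
  "maximal_eigenvalue A r \<longleftrightarrow>
     complex_eigenvalue A (complex_of_real r) \<and> (\<forall>z. complex_eigenvalue A z \<longrightarrow> cmod z \<le> r)"


subsection \<open>The branching process with immigration\<close>

text \<open>The independent sources of randomness.  \<open>Offspring k n i l\<close> is the offspring vector of the
  \<open>l\<close>-th particle of type \<open>i\<close> living in generation \<open>n\<close> and descending from the \<open>k\<close>-th immigration,
  where \<open>k = 0\<close> stands for the descendants of the initial population.\<close>

datatype source = Initial | Offspring nat nat 2 nat | Immigration nat

text \<open>\<open>P i\<close> is the offspring law of a type-\<open>i\<close> particle, \<open>Q\<close> the common law of the immigration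
  vectors \<open>I 1, I 2, \<dots>\<close> (\<open>I 0\<close> is irrelevant), and \<open>U k n\<close> the vector of descendants in
  generation \<open>n\<close> of the \<open>k\<close>-th immigration.\<close>

locale branching_with_immigration = prob_space M for M :: "'w measure" +
  fixes P :: "2 \<Rightarrow> (nat ^ 2) pmf" and Q :: "(nat ^ 2) pmf"
    and \<xi> :: "nat \<Rightarrow> nat \<Rightarrow> 2 \<Rightarrow> nat \<Rightarrow> 'w \<Rightarrow> nat ^ 2"
    and I :: "nat \<Rightarrow> 'w \<Rightarrow> nat ^ 2"
    and Z :: "nat \<Rightarrow> 'w \<Rightarrow> nat ^ 2"
    and U :: "nat \<Rightarrow> nat \<Rightarrow> 'w \<Rightarrow> nat ^ 2"
    and X :: "nat \<Rightarrow> 'w \<Rightarrow> nat ^ 2"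
  assumes independent:
      "indep_vars (\<lambda>_. count_space UNIV)
         (\<lambda>c. case c of Initial \<Rightarrow> Z 0 | Offspring k n i l \<Rightarrow> \<xi> k n i l | Immigration k \<Rightarrow> I k)
         (UNIV - {Immigration 0})"
    and offspring_law: "distr M (count_space UNIV) (\<xi> k n i l) = measure_pmf (P i)"
    and immigration_law: "1 \<le> k \<Longrightarrow> distr M (count_space UNIV) (I k) = measure_pmf Q"
    and Z_Suc: "\<omega> \<in> space M \<Longrightarrow>
      Z (Suc n) \<omega> = (\<Sum>i\<in>UNIV. \<Sum>l<Z n \<omega> $ i. \<xi> 0 n i l \<omega>)"
    and U_start: "1 \<le> k \<Longrightarrow> \<omega> \<in> space M \<Longrightarrow> U k k \<omega> = I k \<omega>"
    and U_Suc: "1 \<le> k \<Longrightarrow> k \<le> n \<Longrightarrow> \<omega> \<in> space M \<Longrightarrow>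
      U k (Suc n) \<omega> = (\<Sum>i\<in>UNIV. \<Sum>l<U k n \<omega> $ i. \<xi> k n i l \<omega>)"
    and X_eq: "\<omega> \<in> space M \<Longrightarrow> X n \<omega> = Z n \<omega> + (\<Sum>k=1..n. U k n \<omega>)"

definition history :: "'w measure \<Rightarrow> (nat \<Rightarrow> 'w \<Rightarrow> nat ^ 2) \<Rightarrow> nat \<Rightarrow> 'w measure" where
  "history M X n = sigma (space M) {X k -` A \<inter> space M | k A. k \<le> n}"

definition normalized ::
    "real \<Rightarrow> real ^ 2 \<Rightarrow> real ^ 2 \<Rightarrow> (nat \<Rightarrow> 'w \<Rightarrow> nat ^ 2) \<Rightarrow> nat \<Rightarrow> 'w \<Rightarrow> real" where
  "normalized \<rho> u lam X n \<omega> =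
     inverse (\<rho> ^ n) *
       (u \<bullet> real_vec (X n \<omega>) - (\<rho> ^ (n + 1) - 1) / (\<rho> - 1) * (u \<bullet> lam))"


subsection \<open>Martingales\<close>

definition martingale :: "'w measure \<Rightarrow> (nat \<Rightarrow> 'w measure) \<Rightarrow> (nat \<Rightarrow> 'w \<Rightarrow> real) \<Rightarrow> bool" where
  "martingale M F Y \<longleftrightarrow>
     filtration (space M) F \<and> (\<forall>n. subalgebra M (F n)) \<and>
     (\<forall>n. Y n \<in> borel_measurable (F n)) \<and>
     (\<forall>n. integrable M (Y n)) \<and>
     (\<forall>n. AE \<omega> in M. real_cond_exp M (F n) (Y (Suc n)) \<omega> = Y n \<omega>)"

end

theory Submission
  imports Defs
begin

text \<open>Every line of descent is measurable with respect to the sources of randomness used so far, and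
  the offspring vectors and the immigration of the next step are independent of these. On an event
  \<open>A\<close> of the past, the expectation of \<open>u \<bullet> X (n + 1)\<close> is therefore \<open>\<rho>\<close> times that of \<open>u \<bullet> X n\<close>
  plus \<open>P(A) (u \<bullet> \<lambda>)\<close>, because \<open>M u = \<rho> u\<close>; after normalization this is the martingale property.
  As \<open>\<rho> > 1\<close>, the compensator \<open>\<rho>\<^sup>-\<^sup>n (\<rho>\<^sup>n\<^sup>+\<^sup>1 - 1) / (\<rho> - 1) (u \<bullet> \<lambda>)\<close> is bounded, so the
  martingale is bounded below, and Doob's upcrossing argument yields almost sure convergence.
  The entries of \<open>M\<close>, defined as limits of partial derivatives of generating functions, are
  identified with the expected offspring numbers by Fatou's lemma.\<close>

subsection \<open>Upcrossings and martingale convergence\<close>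

text \<open>A two-state automaton: a value below \<open>a\<close> switches it on, a value above
  \<open>b\<close> switches it off and completes an upcrossing. Its state at time \<open>n\<close>
  depends on \<open>w 0\<close>, ..., \<open>w n\<close> only, so holding \<open>w\<close> while it
  is on is a predictable strategy.\<close>

fun upcrossing_active :: "real \<Rightarrow> real \<Rightarrow> (nat \<Rightarrow> real) \<Rightarrow> nat \<Rightarrow> bool" where
  "upcrossing_active a b w 0 \<longleftrightarrow> w 0 < a"
| "upcrossing_active a b w (Suc n) \<longleftrightarrow>
     (if upcrossing_active a b w n then w (Suc n) \<le> b else w (Suc n) < a)"

fun upcrossings :: "real \<Rightarrow> real \<Rightarrow> (nat \<Rightarrow> real) \<Rightarrow> nat \<Rightarrow> nat" where
  "upcrossings a b w 0 = 0"
| "upcrossings a b w (Suc n) =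
     upcrossings a b w n + of_bool (upcrossing_active a b w n \<and> b < w (Suc n))"

lemma mono_upcrossings: "mono (upcrossings a b w)"
  by (rule mono_iff_le_Suc[THEN iffD2]) simp

text \<open>The sum is the gain of the strategy that holds one unit of \<open>w\<close> exactly while an upcrossing is
  under way; during an unfinished upcrossing it may lag behind by \<open>a - w n \<le> a\<close>.\<close>

lemma upcrossings_gain:
  assumes "a < b" "0 \<le> a" "\<And>n. 0 \<le> w n"
  shows "(b - a) * real (upcrossings a b w n)
    \<le> a + (\<Sum>k<n. of_bool (upcrossing_active a b w k) * (w (Suc k) - w k))"
proof -
  let ?T = "\<lambda>n. \<Sum>k<n. of_bool (upcrossing_active a b w k) * (w (Suc k) - w k)"
  \<comment> \<open>The induction needs the open position as well, valued as if bought at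
    \<open>a\<close>: this value is negative when an upcrossing starts, follows \<open>w\<close>,
    and exceeds \<open>b - a\<close> when the upcrossing is completed.\<close>
  have "(b - a) * real (upcrossings a b w n)
      + (if upcrossing_active a b w n then w n - a else 0) \<le> ?T n"
  proof (induction n)
    case 0
    then show ?case by simp
  next
    case (Suc n)
    then show ?case
      by (cases "upcrossing_active a b w n"; cases "b < w (Suc n)"; cases "w (Suc n) < a")
        (auto simp: algebra_simps)
  qed
  moreover have "0 \<le> w n" by fact
  ultimately show ?thesis using assms(2) by (auto split: if_splits)
qed

text \<open>In either state a value below \<open>a\<close> leaves the automaton active, and it
  cannot meet a later value above \<open>b\<close> without completing an upcrossing. Hence every
  count is eventually exceeded.\<close>

lemma upcrossings_unbounded:
  assumes "a < b" "\<exists>\<^sub>F n in sequentially. w n < a" "\<exists>\<^sub>F n in sequentially. b < w n"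
  shows "\<exists>n. K \<le> upcrossings a b w n"
proof (induction K)
  case 0
  then show ?case by simp
next
  case (Suc K)
  then obtain n where n: "K \<le> upcrossings a b w n" by blast
  obtain m where m: "n \<le> m" "w m < a"
    using assms(2) unfolding frequently_sequentially by blast
  have act: "upcrossing_active a b w m"
    using m(2) \<open>a < b\<close> by (cases m) auto
  \<comment> \<open>Activity ends only by completing an upcrossing, and the count never
    decreases.\<close>
  have stay: "upcrossing_active a b w (m + j) \<or> upcrossings a b w m < upcrossings a b w (m + j)" for j
  proof (induction j)
    case (Suc j)
    have "upcrossings a b w m \<le> upcrossings a b w (m + j)"
      by (rule monoD[OF mono_upcrossings]) simp
    with Suc show ?case by auto
  qed (use act in simp)
  obtain m' where m': "Suc m \<le> m'" "b < w m'"
    using assms(3) unfolding frequently_sequentially by blast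
  then obtain j where "m' = Suc (m + j)"
    by (metis add_Suc le_Suc_ex)
  then have "upcrossings a b w m < upcrossings a b w m'"
    using stay[of j] m'(2) monoD[OF mono_upcrossings, of m "m + j" a b w] by auto
  moreover have "upcrossings a b w n \<le> upcrossings a b w m"
    using mono_upcrossings m(1) by (rule monoD)
  ultimately show ?case using n by (intro exI[of _ m']) simp
qed

text \<open>If liminf and limsup differed, two rational levels between them would be crossed upwards
  infinitely often. Rational levels keep the number of exceptional null sets countable later; the
  finite liminf excludes divergence to infinity.\<close>

lemma upcrossings_bounded_imp_convergent:
  fixes w :: "nat \<Rightarrow> real"
  assumes nonneg: "\<And>n. 0 \<le> w n"
    and bounded: "\<And>a b. a \<in> \<rat> \<Longrightarrow> b \<in> \<rat> \<Longrightarrow> 0 \<le> a \<Longrightarrow> a < b \<Longrightarrow> \<exists>K. \<forall>n. upcrossings a b w n \<le> K"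
    and finite: "liminf (\<lambda>n. ennreal (w n)) \<noteq> \<infinity>"
  shows "convergent w"
proof -
  have "limsup (\<lambda>n. ennreal (w n)) = liminf (\<lambda>n. ennreal (w n))"
  proof (rule ccontr)
    assume "\<not> ?thesis"
    then have "liminf (\<lambda>n. ennreal (w n)) < limsup (\<lambda>n. ennreal (w n))"
      using Liminf_le_Limsup[of sequentially "\<lambda>n. ennreal (w n)"] by auto
    then obtain c d where cd: "liminf (\<lambda>n. ennreal (w n)) < c" "c < d"
        "d < limsup (\<lambda>n. ennreal (w n))"
      by (meson dense)
    then have fin: "c \<noteq> \<infinity>" "d \<noteq> \<infinity>" by auto
    define c' d' where "c' = enn2real c" "d' = enn2real d"
    have c': "c = ennreal c'" "d = ennreal d'" "0 \<le> c'" "0 \<le> d'"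
      using fin by (auto simp: c'_d'_def ennreal_enn2real_if)
    have "c' < d'" using cd c' by (simp add: ennreal_less_iff)
    then obtain a where a: "a \<in> \<rat>" "c' < a" "a < d'" using Rats_dense_in_real by blast
    then obtain b where b: "b \<in> \<rat>" "a < b" "b < d'" using Rats_dense_in_real by blast
    have "\<exists>\<^sub>F n in sequentially. w n < a"
    proof (rule ccontr)
      assume "\<not> ?thesis"
      then have "\<forall>\<^sub>F n in sequentially. c \<le> ennreal (w n)"
        unfolding not_frequently c' using a by (auto elim!: eventually_mono intro!: ennreal_leI)
      then show False using Liminf_bounded cd(1) by (metis not_le)
    qed
    moreover have "\<exists>\<^sub>F n in sequentially. b < w n"
    proof (rule ccontr)
      assume "\<not> ?thesis"
      then have "\<forall>\<^sub>F n in sequentially. ennreal (w n) \<le> d"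
        unfolding not_frequently c' using b by (auto elim!: eventually_mono intro!: ennreal_leI)
      then show False using Limsup_bounded cd(3) by (metis not_le)
    qed
    ultimately show False
      using upcrossings_unbounded[OF b(2)] bounded[OF a(1) b(1) _ b(2)] a(2) c'(3)
      by (metis less_eq_real_def not_less_eq_eq order_less_le_trans)
  qed
  then obtain L where L: "(\<lambda>n. ennreal (w n)) \<longlonglongrightarrow> L"
    using convergent_ereal unfolding convergent_def by metis
  then have "L = liminf (\<lambda>n. ennreal (w n))"
    by (simp add: lim_imp_Liminf)
  then have "L \<noteq> \<infinity>" using finite by simp
  then obtain l where l: "L = ennreal l" "0 \<le> l" by (cases L) auto
  have "w \<longlonglongrightarrow> l"
    using L l nonneg tendsto_ennreal_iff[of w sequentially l] by auto
  then show ?thesis by (rule convergentI)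
qed

text \<open>Doob's argument: a predictable strategy has nonpositive expected gain on a
  supermartingale, so the expected number of upcrossings of two given levels is bounded uniformly in
  time, while Fatou's lemma keeps the liminf finite. The supermartingale inequality is taken in
  integrated form over events of the past.\<close>

lemma (in prob_space) nonneg_supermartingale_convergent:
  fixes W :: "nat \<Rightarrow> 'a \<Rightarrow> real"
  assumes filt: "filtration (space M) F"
    and sub: "\<And>n. subalgebra M (F n)"
    and adapted: "\<And>n. W n \<in> borel_measurable (F n)"
    and int: "\<And>n. integrable M (W n)"
    and super: "\<And>n A. A \<in> sets (F n) \<Longrightarrow> (\<integral>\<omega>\<in>A. W (Suc n) \<omega> \<partial>M) \<le> (\<integral>\<omega>\<in>A. W n \<omega> \<partial>M)"
    and nonneg: "\<And>n \<omega>. 0 \<le> W n \<omega>"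
  shows "AE \<omega> in M. convergent (\<lambda>n. W n \<omega>)"
proof -
  have spF: "space (F n) = space M" for n using sub by (simp add: subalgebra_def)
  have monoF: "sets (F m) \<subseteq> sets (F n)" if "m \<le> n" for m n
    using filtration.sets_F_mono[OF filt that] by simp
  have adapted': "W m \<in> borel_measurable (F n)" if "m \<le> n" for m n
    using adapted[of m] monoF[OF that] spF by (auto simp: measurable_def)
  have [measurable]: "W n \<in> borel_measurable M" for n
    using int by (rule borel_measurable_integrable)
  \<comment> \<open>Being active at time \<open>n\<close> is an event of \<open>F n\<close>, to
    which \<open>super\<close> applies.\<close>
  have active: "{\<omega>\<in>space M. upcrossing_active a b (\<lambda>k. W k \<omega>) n} \<in> sets (F n)" for a b n
  proof (induction n)
    case 0
    have "{\<omega>\<in>space (F 0). W 0 \<omega> < a} \<in> sets (F 0)" using adapted[of 0] by measurable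
    then show ?case by (simp add: spF)
  next
    case (Suc n)
    have [measurable]: "Measurable.pred (F (Suc n)) (\<lambda>\<omega>. upcrossing_active a b (\<lambda>k. W k \<omega>) n)"
      using Suc monoF[of n "Suc n"] by (auto simp: pred_def spF)
    have [measurable]: "W (Suc n) \<in> borel_measurable (F (Suc n))" by (rule adapted)
    have "{\<omega>\<in>space (F (Suc n)). upcrossing_active a b (\<lambda>k. W k \<omega>) (Suc n)} \<in> sets (F (Suc n))"
      unfolding upcrossing_active.simps by measurable
    then show ?case by (simp only: spF)
  qed
  then have activeM: "{\<omega>\<in>space M. upcrossing_active a b (\<lambda>k. W k \<omega>) n} \<in> sets M" for a b n
    using sub[of n] by (auto simp: subalgebra_def)
  have [measurable]: "Measurable.pred M (\<lambda>\<omega>. upcrossing_active a b (\<lambda>k. W k \<omega>) n)" for a b n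
    using activeM by (simp add: pred_def)
  have [measurable]: "(\<lambda>\<omega>. upcrossings a b (\<lambda>k. W k \<omega>) n) \<in> measurable M (count_space UNIV)" for a b n
    by (induction n) (simp_all add: of_bool_def)
  have gain: "integrable M (\<lambda>\<omega>. of_bool (upcrossing_active a b (\<lambda>k. W k \<omega>) k) * (W (Suc k) \<omega> - W k \<omega>))"
      (is "integrable M ?g")
      "(\<integral>\<omega>. of_bool (upcrossing_active a b (\<lambda>k. W k \<omega>) k) * (W (Suc k) \<omega> - W k \<omega>) \<partial>M) \<le> 0" for a b k
  proof -
    let ?A = "{\<omega>\<in>space M. upcrossing_active a b (\<lambda>k. W k \<omega>) k}"
    have eq: "of_bool (upcrossing_active a b (\<lambda>k. W k \<omega>) k) * (W (Suc k) \<omega> - W k \<omega>)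
        = indicator ?A \<omega> * W (Suc k) \<omega> - indicator ?A \<omega> * W k \<omega>" if "\<omega> \<in> space M" for \<omega>
      using that by (simp add: indicator_def)
    have i: "integrable M (\<lambda>\<omega>. indicator ?A \<omega> * W m \<omega>)" for m
      using integrable_mult_indicator[OF activeM int[of m]] by simp
    show "integrable M ?g"
      by (subst Bochner_Integration.integrable_cong[OF refl eq]) (auto intro!: i)
    have "(\<integral>\<omega>. ?g \<omega> \<partial>M) = (\<integral>\<omega>. indicator ?A \<omega> * W (Suc k) \<omega> - indicator ?A \<omega> * W k \<omega> \<partial>M)"
      by (rule Bochner_Integration.integral_cong[OF refl eq])
    also have "\<dots> = (\<integral>\<omega>. indicator ?A \<omega> * W (Suc k) \<omega> \<partial>M) - (\<integral>\<omega>. indicator ?A \<omega> * W k \<omega> \<partial>M)"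
      by (intro Bochner_Integration.integral_diff i)
    also have "\<dots> \<le> 0"
      using super[OF active[of a b k]] by (simp add: set_lebesgue_integral_def)
    finally show "(\<integral>\<omega>. ?g \<omega> \<partial>M) \<le> 0" .
  qed
  have bounded: "AE \<omega> in M. \<exists>K. \<forall>n. upcrossings a b (\<lambda>k. W k \<omega>) n \<le> K"
    if ab: "0 \<le> a" "a < b" for a b
  proof -
    let ?U = "\<lambda>n \<omega>. upcrossings a b (\<lambda>k. W k \<omega>) n"
    \<comment> \<open>Doob's upcrossing inequality: after taking expectations in
      \<open>upcrossings_gain\<close> only the constant \<open>a\<close> remains, independently of
      \<open>n\<close>.\<close>
    have le: "(\<integral>\<^sup>+\<omega>. ennreal (?U n \<omega>) \<partial>M) \<le> ennreal (a / (b - a))" for n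
    proof -
      let ?G = "\<lambda>\<omega>. \<Sum>k<n. of_bool (upcrossing_active a b (\<lambda>k. W k \<omega>) k) * (W (Suc k) \<omega> - W k \<omega>)"
      have Gi: "integrable M ?G" by (intro Bochner_Integration.integrable_sum gain)
      have pw: "real (?U n \<omega>) \<le> (a + ?G \<omega>) / (b - a)" for \<omega>
        using upcrossings_gain[OF ab(2,1), of "\<lambda>k. W k \<omega>" n] nonneg ab
        by (simp add: field_simps)
      have "(\<integral>\<^sup>+\<omega>. ennreal (?U n \<omega>) \<partial>M) \<le> (\<integral>\<^sup>+\<omega>. ennreal ((a + ?G \<omega>) / (b - a)) \<partial>M)"
        by (intro nn_integral_mono ennreal_leI pw)
      also have "\<dots> = ennreal (\<integral>\<omega>. (a + ?G \<omega>) / (b - a) \<partial>M)"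
        by (intro nn_integral_eq_integral AE_I2 order_trans[OF of_nat_0_le_iff pw]
            integrable_divide Bochner_Integration.integrable_add Gi) simp
      also have "(\<integral>\<omega>. (a + ?G \<omega>) / (b - a) \<partial>M) = (a + (\<integral>\<omega>. ?G \<omega> \<partial>M)) / (b - a)"
        using Gi by (simp add: prob_space)
      also have "\<dots> \<le> ennreal (a / (b - a))"
      proof (intro ennreal_leI divide_right_mono)
        have "(\<integral>\<omega>. ?G \<omega> \<partial>M) \<le> 0"
          by (subst Bochner_Integration.integral_sum) (auto intro!: gain sum_nonpos)
        then show "a + (\<integral>\<omega>. ?G \<omega> \<partial>M) \<le> a" by simp
      qed (use ab in simp)
      finally show ?thesis .
    qed
    \<comment> \<open>Monotone convergence carries the bound over to the total number of
      upcrossings, which is therefore almost surely finite.\<close>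
    have "(\<integral>\<^sup>+\<omega>. (SUP n. ennreal (?U n \<omega>)) \<partial>M) = (SUP n. \<integral>\<^sup>+\<omega>. ennreal (?U n \<omega>) \<partial>M)"
      using mono_upcrossings[THEN monoD]
      by (intro nn_integral_monotone_convergence_SUP) (auto simp: mono_def le_fun_def incseq_def intro!: ennreal_leI)
    also have "\<dots> \<le> ennreal (a / (b - a))" by (intro SUP_least le)
    finally have "(\<integral>\<^sup>+\<omega>. (SUP n. ennreal (?U n \<omega>)) \<partial>M) \<noteq> \<infinity>"
      by (auto simp: top_unique)
    then have "AE \<omega> in M. (SUP n. ennreal (?U n \<omega>)) \<noteq> \<infinity>"
      by (intro nn_integral_PInf_AE) auto
    then show ?thesis
    proof eventually_elim
      case (elim \<omega>)
      then obtain r where r: "(SUP n. ennreal (?U n \<omega>)) = ennreal r" "0 \<le> r"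
        by (cases "SUP n. ennreal (?U n \<omega>)") auto
      have "ennreal (?U n \<omega>) \<le> ennreal r" for n
        unfolding r(1)[symmetric] by (rule SUP_upper) simp
      then have "real (?U n \<omega>) \<le> r" for n using r(2) by (simp add: ennreal_le_iff)
      then show ?case by (metis le_nat_floor)
    qed
  qed
  let ?R = "{(a, b). a \<in> \<rat> \<and> b \<in> \<rat> \<and> 0 \<le> a \<and> a < (b :: real)}"
  have "countable ?R"
    by (rule countable_subset[of _ "\<rat> \<times> \<rat>"]) (auto simp: countable_rat)
  then have "AE \<omega> in M. \<forall>p\<in>?R. \<exists>K. \<forall>n. upcrossings (fst p) (snd p) (\<lambda>k. W k \<omega>) n \<le> K"
    by (subst AE_ball_countable) (auto intro: bounded)
  moreover have "AE \<omega> in M. liminf (\<lambda>n. ennreal (W n \<omega>)) \<noteq> \<infinity>"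
  proof (rule nn_integral_PInf_AE)
    \<comment> \<open>Decreasing expectations bound the right-hand side of Fatou's lemma by the
      expectation at time 0.\<close>
    have le: "(\<integral>\<omega>. W n \<omega> \<partial>M) \<le> (\<integral>\<omega>. W 0 \<omega> \<partial>M)" for n
    proof (induction n)
      case (Suc n)
      have "(\<integral>\<omega>. W (Suc n) \<omega> \<partial>M) \<le> (\<integral>\<omega>. W n \<omega> \<partial>M)"
        using super[OF sets.top, of n] by (simp add: spF set_integral_space[OF int])
      with Suc show ?case by simp
    qed simp
    have "(\<integral>\<^sup>+\<omega>. liminf (\<lambda>n. ennreal (W n \<omega>)) \<partial>M) \<le> liminf (\<lambda>n. \<integral>\<^sup>+\<omega>. ennreal (W n \<omega>) \<partial>M)"
      by (intro nn_integral_liminf) simp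
    also have "\<dots> \<le> liminf (\<lambda>n. ennreal (\<integral>\<omega>. W 0 \<omega> \<partial>M))"
      by (intro Liminf_mono always_eventually allI)
        (auto simp: nn_integral_eq_integral int nonneg intro!: ennreal_leI le)
    finally show "(\<integral>\<^sup>+\<omega>. liminf (\<lambda>n. ennreal (W n \<omega>)) \<partial>M) \<noteq> \<infinity>"
      by (auto simp: Liminf_const top_unique)
  qed simp
  ultimately show ?thesis
  proof eventually_elim
    case (elim \<omega>)
    show ?case
      by (rule upcrossings_bounded_imp_convergent) (use elim nonneg in auto)
  qed
qed

text \<open>Adding the constant \<open>c\<close> makes the process nonnegative, and integrating the
  conditional expectation over an event of \<open>F n\<close> gives the integrated form of the
  martingale property.\<close>

lemma (in prob_space) martingale_convergent:
  assumes mart: "martingale M F Y" and bound: "\<And>n \<omega>. - c \<le> Y n \<omega>"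
  shows "AE \<omega> in M. convergent (\<lambda>n. Y n \<omega>)"
proof -
  note m = mart[unfolded martingale_def]
  have sub: "subalgebra M (F n)" for n using m by simp
  have int: "integrable M (Y n)" for n using m by simp
  have "AE \<omega> in M. convergent (\<lambda>n. Y n \<omega> + c)"
  proof (rule nonneg_supermartingale_convergent[where F = F])
    fix n A assume A: "A \<in> sets (F n)"
    then have AM: "A \<in> sets M" using sub[of n] by (auto simp: subalgebra_def)
    interpret sigma_finite_subalgebra M "F n"
      by (intro finite_measure_subalgebra_is_sigma_finite finite_measure_subalgebra.intro
          finite_measure_subalgebra_axioms.intro finite_measure_axioms sub)
    have "(\<integral>\<omega>\<in>A. Y (Suc n) \<omega> \<partial>M) = (\<integral>\<omega>\<in>A. real_cond_exp M (F n) (Y (Suc n)) \<omega> \<partial>M)"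
      by (rule real_cond_exp_intA[OF int A])
    also have "\<dots> = (\<integral>\<omega>\<in>A. Y n \<omega> \<partial>M)"
    proof (rule set_lebesgue_integral_cong_AE[OF AM])
      show "AE \<omega> \<in> A in M. real_cond_exp M (F n) (Y (Suc n)) \<omega> = Y n \<omega>"
        using m by auto
    qed (use int in auto)
    finally have eq: "(\<integral>\<omega>\<in>A. Y (Suc n) \<omega> \<partial>M) = (\<integral>\<omega>\<in>A. Y n \<omega> \<partial>M)" .
    have "(\<integral>\<omega>\<in>A. Y k \<omega> + c \<partial>M) = (\<integral>\<omega>\<in>A. Y k \<omega> \<partial>M) + (\<integral>\<omega>\<in>A. c \<partial>M)" for k
      unfolding set_lebesgue_integral_def distrib_left scaleR_conv_of_real of_real_eq_id id_def
      by (intro Bochner_Integration.integral_add) (use integrable_mult_indicator[OF AM int[of k]] AM in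
          \<open>auto intro!: integrable_mult_left integrable_real_indicator simp: less_top[symmetric]\<close>)
    then show "(\<integral>\<omega>\<in>A. Y (Suc n) \<omega> + c \<partial>M) \<le> (\<integral>\<omega>\<in>A. Y n \<omega> + c \<partial>M)"
      using eq by simp
  next
    show "0 \<le> Y n \<omega> + c" for n \<omega> using bound[of n \<omega>] by simp
  qed (use m in \<open>auto intro!: borel_measurable_add\<close>)
  then show ?thesis
    by eventually_elim (simp add: convergent_add_const_right_iff)
qed

subsection \<open>Offspring means\<close>

text \<open>Sorting by the value of \<open>N\<close> exhibits the expectation as a power series in
  \<open>t\<close>; a geometric series dominates it and justifies the exchange. The factor
  \<open>g\<close> will hold the powers of the other coordinates.\<close>

lemma pmf_power_expectation_sums:
  fixes p :: "'a pmf" and g :: "'a \<Rightarrow> real" and N :: "'a \<Rightarrow> nat"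
  assumes g: "\<And>x. 0 \<le> g x" "\<And>x. g x \<le> 1" and t: "\<bar>t\<bar> < 1"
  shows "(\<lambda>k. measure_pmf.expectation p (\<lambda>x. g x * of_bool (N x = k)) * t ^ k)
    sums measure_pmf.expectation p (\<lambda>x. g x * t ^ N x)"
proof -
  let ?c = "\<lambda>k. measure_pmf.expectation p (\<lambda>x. g x * of_bool (N x = k))"
  let ?f = "\<lambda>k x. g x * of_bool (N x = k) * t ^ k"
  have bd: "norm (?f k x) \<le> \<bar>t\<bar> ^ k" for k x
    using g[of x] by (auto simp: abs_mult power_abs of_bool_def intro: mult_left_le_one_le)
  have int: "integrable p (?f k)" for k
    by (rule measure_pmf.integrable_const_bound[where B = "\<bar>t\<bar> ^ k"], rule AE_I2, rule bd) simp
  have geo: "summable (\<lambda>k. \<bar>t\<bar> ^ k)" using t by (simp add: summable_geometric)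
  have "(\<lambda>k. measure_pmf.expectation p (?f k)) sums measure_pmf.expectation p (\<lambda>x. \<Sum>k. ?f k x)"
  proof (rule sums_integral[OF int])
    show "AE x in p. summable (\<lambda>k. norm (?f k x))"
      by (rule AE_I2) (rule summable_comparison_test'[OF geo, of 0], use bd in simp)
    have "(\<integral>x. norm (?f k x) \<partial>measure_pmf p) \<le> \<bar>t\<bar> ^ k" for k
      using integral_mono[of p "\<lambda>x. norm (?f k x)" "\<lambda>_. \<bar>t\<bar> ^ k"] bd int
      by (simp add: measure_pmf.prob_space integrable_norm)
    then show "summable (\<lambda>k. \<integral>x. norm (?f k x) \<partial>measure_pmf p)"
      by (intro summable_comparison_test'[OF geo, of 0]) simp
  qed
  moreover have "(\<Sum>k. ?f k x) = g x * t ^ N x" for x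
    by (subst suminf_finite[of "{N x}"]) auto
  ultimately show ?thesis by simp
qed

text \<open>The power series is differentiated term by term inside its disc of convergence. The
  resulting terms are nonnegative, so sum and integral can be exchanged back. The truncated exponent
  \<open>N x - 1\<close> is harmless, as \<open>N x = 0\<close> gives the factor 0.\<close>

lemma pmf_power_expectation_deriv:
  fixes p :: "'a pmf" and g :: "'a \<Rightarrow> real" and N :: "'a \<Rightarrow> nat"
  assumes g: "\<And>x. 0 \<le> g x" "\<And>x. g x \<le> 1" and t: "0 \<le> t" "t < 1"
  shows "ennreal (deriv (\<lambda>t. measure_pmf.expectation p (\<lambda>x. g x * t ^ N x)) t)
    = (\<integral>\<^sup>+x. ennreal (g x * (real (N x) * t ^ (N x - 1))) \<partial>measure_pmf p)"
    and "0 \<le> deriv (\<lambda>t. measure_pmf.expectation p (\<lambda>x. g x * t ^ N x)) t"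
proof -
  let ?F = "\<lambda>t. measure_pmf.expectation p (\<lambda>x. g x * t ^ N x)"
  define c where "c k = measure_pmf.expectation p (\<lambda>x. g x * of_bool (N x = k))" for k
  have c0: "0 \<le> c k" for k
    unfolding c_def using g by (intro Bochner_Integration.integral_nonneg) simp
  have sums: "(\<lambda>k. c k * s ^ k) sums ?F s" if "\<bar>s\<bar> < 1" for s
    unfolding c_def by (rule pmf_power_expectation_sums[OF g that])
  obtain K where K: "t < K" "K < 1" using dense t by blast
  have "((\<lambda>s. \<Sum>k. c k * s ^ k) has_field_derivative (\<Sum>k. diffs c k * t ^ k)) (at t)"
    by (rule termdiffs_strong[of _ K]) (use K t sums[of K] in \<open>auto simp: sums_iff\<close>)
  \<comment> \<open>The neighbourhood reaches into negative arguments: \<open>t\<close> may be 0 and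
    the derivative is two-sided.\<close>
  moreover have "\<forall>\<^sub>F s in nhds t. (\<Sum>k. c k * s ^ k) = ?F s"
    using eventually_nhds_in_open[of "{-1<..<1}" t] t
    by (auto elim!: eventually_mono simp: sums[THEN sums_unique, symmetric])
  ultimately have "(?F has_field_derivative (\<Sum>k. diffs c k * t ^ k)) (at t)"
    by (subst (asm) DERIV_cong_ev[OF refl _ refl]) auto
  then have D: "deriv ?F t = (\<Sum>k. diffs c k * t ^ k)" by (rule DERIV_imp_deriv)
  have smb: "summable (\<lambda>k. diffs c k * t ^ k)"
    by (rule termdiff_converges[of _ 1]) (use t sums in \<open>auto simp: sums_iff\<close>)
  have nn: "0 \<le> diffs c k * t ^ k" for k
    using c0 t by (simp add: diffs_def)
  show "0 \<le> deriv ?F t" unfolding D using smb nn by (rule suminf_nonneg)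
  have int: "integrable p (\<lambda>x. g x * of_bool (N x = k))" for k
    by (rule measure_pmf.integrable_const_bound[where B = 1]) (use g in auto)
  have "ennreal (deriv ?F t) = (\<Sum>k. ennreal (diffs c k * t ^ k))"
    unfolding D by (rule suminf_ennreal2[symmetric]) (use nn smb in auto)
  also have "\<dots> = (\<Sum>k. \<integral>\<^sup>+x. ennreal (g x * of_bool (N x = Suc k) * (real (Suc k) * t ^ k)) \<partial>measure_pmf p)"
  proof (rule arg_cong[where f = suminf], rule ext)
    fix k
    have "diffs c k * t ^ k = (\<integral>x. g x * of_bool (N x = Suc k) * (real (Suc k) * t ^ k) \<partial>measure_pmf p)"
      by (simp add: diffs_def c_def)
    also have "ennreal \<dots> = (\<integral>\<^sup>+x. ennreal (g x * of_bool (N x = Suc k) * (real (Suc k) * t ^ k)) \<partial>measure_pmf p)"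
      using g t by (intro nn_integral_eq_integral[symmetric] integrable_mult_left int AE_I2) auto
    finally show "ennreal (diffs c k * t ^ k) = \<dots>" .
  qed
  also have "\<dots> = (\<integral>\<^sup>+x. (\<Sum>k. ennreal (g x * of_bool (N x = Suc k) * (real (Suc k) * t ^ k))) \<partial>measure_pmf p)"
    by (rule nn_integral_suminf[symmetric]) simp
  also have "\<dots> = (\<integral>\<^sup>+x. ennreal (g x * (real (N x) * t ^ (N x - 1))) \<partial>measure_pmf p)"
  proof (rule nn_integral_cong)
    fix x
    show "(\<Sum>k. ennreal (g x * of_bool (N x = Suc k) * (real (Suc k) * t ^ k)))
      = ennreal (g x * (real (N x) * t ^ (N x - 1)))"
    proof (cases "N x")
      case (Suc m)
      then show ?thesis by (subst suminf_finite[of "{m}"]) auto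
    qed simp
  qed
  finally show "ennreal (deriv ?F t) = \<dots>" .
qed

section \<open>Offspring generating functions and their partial derivatives\<close>

lemma offspring_gf_expectation:
  assumes "\<And>a. \<bar>s $ a\<bar> \<le> 1"
  shows "offspring_gf P s $ i = measure_pmf.expectation (P i) (\<lambda>x. \<Prod>a\<in>UNIV. s $ a ^ (x $ a))"
proof -
  let ?h = "\<lambda>x. \<Prod>a\<in>UNIV. s $ a ^ (x $ a)"
  have "\<bar>?h x\<bar> \<le> 1" for x :: "nat ^ 2"
    using assms by (auto simp: abs_prod power_abs intro!: prod_le_1 power_le_one)
  then have "integrable (measure_pmf (P i)) ?h"
    by (intro measure_pmf.integrable_const_bound[where B = 1]) auto
  \<comment> \<open>The unordered sum in the definition has a meaningful value because it converges
    absolutely, the monomial being bounded by 1.\<close>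
  then have "Infinite_Set_Sum.abs_summable_on (\<lambda>x. pmf (P i) x * ?h x) UNIV"
    by (simp add: Infinite_Set_Sum.abs_summable_on_def measure_pmf_eq_density integrable_density)
  moreover have "?h x = s $ 1 ^ (x $ 1) * s $ 2 ^ (x $ 2)" for x :: "nat ^ 2"
    by (simp add: UNIV_2)
  ultimately show ?thesis
    by (simp add: offspring_gf_def pmf_expectation_eq_infsetsum infsetsum_infsum)
qed

text \<open>With the other coordinate frozen, the generating function is a power expectation in
  coordinate \<open>b\<close>, whose factor \<open>g\<close> is the remaining monomial.\<close>

lemma offspring_gf_partial_nn_integral:
  assumes s: "\<And>a. 0 \<le> s $ a" "\<And>a. s $ a < 1"
  shows "ennreal (offspring_gf_partial P i b s)
    = (\<integral>\<^sup>+x. ennreal ((\<Prod>a\<in>UNIV - {b}. s $ a ^ (x $ a)) * (real (x $ b) * s $ b ^ (x $ b - 1)))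
        \<partial>measure_pmf (P i))"
    and "0 \<le> offspring_gf_partial P i b s"
proof -
  let ?g = "\<lambda>x :: nat ^ 2. \<Prod>a\<in>UNIV - {b}. s $ a ^ (x $ a)"
  have g: "0 \<le> ?g x" "?g x \<le> 1" for x
    using s less_imp_le[OF s(2)] by (auto intro!: prod_nonneg prod_le_1 power_le_one)
  \<comment> \<open>The derivative only sees values near \<open>s $ b\<close>, where all coordinates
    stay in the region on which the series is an expectation.\<close>
  have "\<forall>\<^sub>F t in nhds (s $ b). offspring_gf P (\<chi> a. if a = b then t else s $ a) $ i
      = measure_pmf.expectation (P i) (\<lambda>x. ?g x * t ^ (x $ b))"
  proof (rule eventually_mono)
    show "\<forall>\<^sub>F t in nhds (s $ b). t \<in> {-1<..<1}"
      using s[of b] by (intro eventually_nhds_in_open) auto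
    fix t :: real assume t: "t \<in> {-1<..<1}"
    have "\<bar>(\<chi> a. if a = b then t else s $ a) $ c\<bar> \<le> 1" for c
      using t s(1)[of c] s(2)[of c] by auto
    moreover have "(\<Prod>a\<in>UNIV. (\<chi> a. if a = b then t else s $ a) $ a ^ (x $ a)) = ?g x * t ^ (x $ b)"
      for x :: "nat ^ 2"
      by (subst prod.remove[of _ b]) (auto intro!: prod.cong)
    ultimately show "offspring_gf P (\<chi> a. if a = b then t else s $ a) $ i
      = measure_pmf.expectation (P i) (\<lambda>x. ?g x * t ^ (x $ b))"
      by (subst offspring_gf_expectation) simp_all
  qed
  then have eq: "offspring_gf_partial P i b s
    = deriv (\<lambda>t. measure_pmf.expectation (P i) (\<lambda>x. ?g x * t ^ (x $ b))) (s $ b)"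
    unfolding offspring_gf_partial_def by (rule deriv_cong_ev) simp
  show "ennreal (offspring_gf_partial P i b s)
      = (\<integral>\<^sup>+x. ennreal (?g x * (real (x $ b) * s $ b ^ (x $ b - 1))) \<partial>measure_pmf (P i))"
    and "0 \<le> offspring_gf_partial P i b s"
    unfolding eq by (intro pmf_power_expectation_deriv[of ?g "s $ b" "P i" "\<lambda>x. x $ b"] g s)+
qed

text \<open>Along every sequence approaching \<open>1\<close> from inside the square, the integrands
  tend to \<open>x $ b\<close> and stay below it. The bound controls the limsup and Fatou's lemma
  the liminf, so an infinite mean is covered too.\<close>

lemma offspring_mean_eq:
  "offspring_mean P i b = enn2ereal (\<integral>\<^sup>+x. of_nat (x $ b) \<partial>measure_pmf (P i))"
proof -
  let ?S = "{s :: real ^ 2. \<forall>a. 0 \<le> s $ a \<and> s $ a < 1}"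
  let ?m = "\<integral>\<^sup>+x. of_nat (x $ b) \<partial>measure_pmf (P i)"
  let ?h = "\<lambda>s x. (\<Prod>a\<in>UNIV - {b}. s $ a ^ (x $ a)) * (real (x $ b) * s $ b ^ (x $ b - 1))"
  have "((\<lambda>s. ereal (offspring_gf_partial P i b s)) \<longlongrightarrow> enn2ereal ?m) (at 1 within ?S)"
    unfolding tendsto_at_iff_sequentially comp_def
  proof (intro allI impI)
    fix s :: "nat \<Rightarrow> real ^ 2"
    assume inS: "\<forall>n. s n \<in> ?S - {1}" and lim: "s \<longlonglongrightarrow> 1"
    have s: "0 \<le> s n $ a" "s n $ a < 1" for n a using inS by auto
    have upper: "ennreal (?h (s n) x) \<le> of_nat (x $ b)" for n x
    proof -
      have "(\<Prod>a\<in>UNIV - {b}. s n $ a ^ (x $ a)) \<le> 1"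
        using s less_imp_le[OF s(2)] by (auto intro!: prod_le_1 power_le_one)
      moreover have "0 \<le> (\<Prod>a\<in>UNIV - {b}. s n $ a ^ (x $ a))" using s by (auto intro!: prod_nonneg)
      moreover have "real (x $ b) * s n $ b ^ (x $ b - 1) \<le> real (x $ b)"
        using s less_imp_le[OF s(2)] by (auto intro!: mult_left_le power_le_one)
      ultimately have "?h (s n) x \<le> 1 * real (x $ b)"
        using s by (intro mult_mono) auto
      then show ?thesis by (simp add: ennreal_of_nat_eq_real_of_nat ennreal_leI)
    qed
    have hlim: "(\<lambda>n. ennreal (?h (s n) x)) \<longlonglongrightarrow> of_nat (x $ b)" for x
    proof -
      have "(\<lambda>n. s n $ a) \<longlonglongrightarrow> 1" for a using tendsto_vec_nth[OF lim, of a] by simp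
      then have "(\<lambda>n. ?h (s n) x) \<longlonglongrightarrow> (\<Prod>a\<in>UNIV - {b}. 1 ^ (x $ a)) * (real (x $ b) * 1 ^ (x $ b - 1))"
        by (intro tendsto_intros)
      then show ?thesis
        by (simp add: ennreal_of_nat_eq_real_of_nat tendsto_ennrealI)
    qed
    have "(\<lambda>n. \<integral>\<^sup>+x. ennreal (?h (s n) x) \<partial>measure_pmf (P i)) \<longlonglongrightarrow> ?m"
    proof -
      let ?I = "\<lambda>n. \<integral>\<^sup>+x. ennreal (?h (s n) x) \<partial>measure_pmf (P i)"
      have upper_lim: "limsup ?I \<le> ?m"
        by (intro Limsup_bounded always_eventually allI nn_integral_mono upper)
      have "?m = (\<integral>\<^sup>+x. liminf (\<lambda>n. ennreal (?h (s n) x)) \<partial>measure_pmf (P i))"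
        by (intro nn_integral_cong lim_imp_Liminf[symmetric] hlim) simp
      also have "\<dots> \<le> liminf ?I" by (rule nn_integral_liminf) simp
      finally have lower_lim: "?m \<le> liminf ?I" .
      have "liminf ?I \<le> limsup ?I" by (rule Liminf_le_Limsup) simp
      with upper_lim lower_lim show ?thesis
        by (intro tendsto_iff_Liminf_eq_Limsup[THEN iffD2] conjI antisym) auto
    qed
    then have "(\<lambda>n. ennreal (offspring_gf_partial P i b (s n))) \<longlonglongrightarrow> ?m"
      using offspring_gf_partial_nn_integral(1)[of "s _"] s by simp
    from tendsto_enn2erealI[OF this]
    show "(\<lambda>n. ereal (offspring_gf_partial P i b (s n))) \<longlonglongrightarrow> enn2ereal ?m"
      using offspring_gf_partial_nn_integral(2)[of "s _"] s by (simp add: enn2ereal_ennreal)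
  qed
  \<comment> \<open>Uniqueness of the limit behind \<open>Lim\<close> requires that \<open>1\<close>
    be a limit point of the square; the diagonal sequence with coordinates
    \<open>1 - 1 / (n + 1)\<close> shows it.\<close>
  moreover have "at (1 :: real ^ 2) within ?S \<noteq> bot"
  proof -
    define s :: "nat \<Rightarrow> real ^ 2" where "s n = (\<chi> a. 1 - inverse (real (Suc n)))" for n
    have "s n \<in> ?S - {1}" for n
      by (auto simp: s_def vec_eq_iff field_simps)
    moreover have "s \<longlonglongrightarrow> 1"
      using LIMSEQ_inverse_real_of_nat_add_minus[of 1] by (intro vec_tendstoI) (simp add: s_def)
    ultimately show ?thesis
      unfolding trivial_limit_within islimpt_sequential by blast
  qed
  ultimately show ?thesis
    unfolding offspring_mean_def by (intro tendsto_Lim)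
qed

text \<open>\<open>real_of_ereal\<close> sends infinity to 0, so matrix entries are true means only
  when these are finite.\<close>

lemma mean_matrix_nn_integral:
  assumes "offspring_mean P i b < \<infinity>"
  shows "(\<integral>\<^sup>+x. of_nat (x $ b) \<partial>measure_pmf (P i)) = ennreal (mean_matrix P $ i $ b)"
    and "0 \<le> mean_matrix P $ i $ b"
proof -
  let ?m = "\<integral>\<^sup>+x. of_nat (x $ b) \<partial>measure_pmf (P i)"
  have "?m \<noteq> \<infinity>" using assms by (simp add: offspring_mean_eq)
  then obtain r where "?m = ennreal r" "0 \<le> r" by (cases ?m) auto
  then show "?m = ennreal (mean_matrix P $ i $ b)" "0 \<le> mean_matrix P $ i $ b"
    by (simp_all add: mean_matrix_def offspring_mean_eq enn2ereal_ennreal)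
qed

subsection \<open>One step of the branching process\<close>

lemma space_history [simp]: "space (history M X n) = space M"
  by (simp add: history_def space_measure_of_conv)

lemma sets_history: "sets (history M X n) = sigma_sets (space M) {X k -` A \<inter> space M | k A. k \<le> n}"
  unfolding history_def by (rule sets_measure_of) auto

lemma filtration_history: "filtration (space M) (history M X)"
proof unfold_locales
  show "sets (history M X m) \<subseteq> sets (history M X n)" if "m \<le> n" for m n
    unfolding sets_history using that order_trans by (intro sigma_sets_mono') blast
qed simp

lemma measurable_history: "X n \<in> measurable (history M X n) (count_space UNIV)"
  by (rule measurableI) (auto simp: sets_history intro!: sigma_sets.Basic)

text \<open>\<open>A\<close> is determined by the sources in \<open>J\<close>, hence independent of
  \<open>S c\<close>: restricted to \<open>A\<close>, the variable \<open>S c\<close> has law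
  \<open>N\<close> scaled by the probability of \<open>A\<close>. Integrating \<open>g\<close>
  against this law gives the product.\<close>

lemma (in prob_space) nn_integral_indep_past:
  assumes ind: "indep_vars (\<lambda>_. count_space UNIV) S I" and c: "c \<in> I" "c \<notin> J" and J: "J \<subseteq> I"
    and A: "A \<in> sets (vimage_algebra (space M) (\<lambda>\<omega>. \<lambda>i\<in>J. S i \<omega>) (\<Pi>\<^sub>M i\<in>J. count_space UNIV))"
    and law: "distr M (count_space UNIV) (S c) = N"
  shows "(\<integral>\<^sup>+\<omega>. indicator A \<omega> * g (S c \<omega>) \<partial>M) = emeasure M A * (\<integral>\<^sup>+x. g x \<partial>N)"
proof -
  have [measurable]: "S i \<in> measurable M (count_space UNIV)" if "i \<in> I" for i
    using ind that by (simp add: indep_vars_def2)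
  have Sc[measurable]: "S c \<in> measurable M (count_space UNIV)" using c by simp
  have f: "(\<lambda>\<omega>. \<lambda>i\<in>J. S i \<omega>) \<in> measurable M (\<Pi>\<^sub>M i\<in>J. count_space UNIV)"
    using J by (intro measurable_restrict) auto
  obtain B where B: "B \<in> sets (\<Pi>\<^sub>M i\<in>J. count_space UNIV)"
      "A = (\<lambda>\<omega>. \<lambda>i\<in>J. S i \<omega>) -` B \<inter> space M"
    using A measurable_space[OF f] by (subst (asm) sets_vimage_algebra2) auto
  have [measurable]: "A \<in> sets M" unfolding B(2) using f B(1) by (rule measurable_sets)
  have indep: "indep_var (\<Pi>\<^sub>M i\<in>J. count_space UNIV) (\<lambda>\<omega>. \<lambda>i\<in>J. S i \<omega>)
      (\<Pi>\<^sub>M i\<in>{c}. count_space UNIV) (\<lambda>\<omega>. \<lambda>i\<in>{c}. S i \<omega>)"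
    using c J by (intro indep_var_restrict[OF ind]) auto
  have "distr (density M (indicator A)) (count_space UNIV) (S c) = scale_measure (emeasure M A) N"
  proof (rule measure_eqI)
    show "sets (distr (density M (indicator A)) (count_space UNIV) (S c))
        = sets (scale_measure (emeasure M A) N)"
      by (simp flip: law)
    fix C
    \<comment> \<open>Independence is available for families of sources, so \<open>C\<close> is
      lifted to the product over the single index \<open>c\<close>.\<close>
    define D :: "('b \<Rightarrow> 'c) set" where
      "D = (\<lambda>h. h c) -` C \<inter> space (\<Pi>\<^sub>M i\<in>{c}. count_space UNIV)"
    have D: "D \<in> sets (\<Pi>\<^sub>M i\<in>{c}. count_space UNIV)"
      unfolding D_def by (rule measurable_sets[OF measurable_component_singleton]) auto
    have eq: "(\<lambda>\<omega>. (\<lambda>i\<in>J. S i \<omega>, \<lambda>i\<in>{c}. S i \<omega>)) -` (B \<times> D) \<inter> space M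
        = A \<inter> (S c -` C \<inter> space M)"
      "(\<lambda>\<omega>. \<lambda>i\<in>{c}. S i \<omega>) -` D \<inter> space M = S c -` C \<inter> space M"
      by (auto simp: B D_def space_PiM)
    have "emeasure (distr (density M (indicator A)) (count_space UNIV) (S c)) C
        = (\<integral>\<^sup>+\<omega>. indicator A \<omega> * indicator (S c -` C \<inter> space M) \<omega> \<partial>M)"
      by (simp add: emeasure_distr emeasure_density)
    also have "\<dots> = emeasure M (A \<inter> (S c -` C \<inter> space M))"
      by (simp flip: indicator_inter_arith)
    also have "\<dots> = emeasure M A * emeasure M (S c -` C \<inter> space M)"
      using indep_varD[OF indep B(1) D]
      by (simp add: eq emeasure_eq_measure ennreal_mult B(2)[symmetric])
    also have "emeasure M (S c -` C \<inter> space M) = emeasure N C"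
      by (simp add: emeasure_distr flip: law)
    finally show "emeasure (distr (density M (indicator A)) (count_space UNIV) (S c)) C
        = emeasure (scale_measure (emeasure M A) N) C"
      by simp
  qed
  then have "(\<integral>\<^sup>+x. g x \<partial>distr (density M (indicator A)) (count_space UNIV) (S c))
      = emeasure M A * (\<integral>\<^sup>+x. g x \<partial>N)"
    by (subst \<open>_ = scale_measure _ _\<close>) (simp add: nn_integral_scale_measure flip: law)
  moreover have "(\<lambda>\<omega>. g (S c \<omega>)) \<in> borel_measurable M"
    by (rule measurable_compose[OF Sc]) simp
  ultimately show ?thesis
    by (simp add: nn_integral_distr nn_integral_density)
qed

lemma measurable_count_space_sum:
  fixes f :: "'i \<Rightarrow> 'a \<Rightarrow> 'b :: {countable, comm_monoid_add}"
  assumes "\<And>i. i \<in> I \<Longrightarrow> f i \<in> measurable N (count_space UNIV)"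
  shows "(\<lambda>x. \<Sum>i\<in>I. f i x) \<in> measurable N (count_space UNIV)"
  using assms
proof (induction I rule: infinite_finite_induct)
  case (insert i I)
  have "(\<lambda>x. y + (\<Sum>i\<in>I. f i x)) \<in> measurable N (count_space UNIV)" for y
    by (rule measurable_compose[OF insert.IH measurable_count_space]) (use insert.prems in simp)
  from measurable_compose_countable[OF this, of "f i"] show ?case
    using insert by simp
qed auto

text \<open>Turns a sum with a random number of terms into a series of indicators, which can be
  integrated term by term.\<close>

lemma suminf_if_less:
  "(\<Sum>l. if l < m then f l else (0::ennreal)) = (\<Sum>l<m. f l)"
  by (subst suminf_finite[of "{..<m}"]) auto

text \<open>Weights in \<open>ennreal\<close> let expectations be computed before any moment is
  known to be finite.\<close>

definition type_weight :: "(2 \<Rightarrow> ennreal) \<Rightarrow> nat ^ 2 \<Rightarrow> ennreal" where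
  "type_weight v x = (\<Sum>a\<in>UNIV. v a * of_nat (x $ a))"

lemma type_weight_add: "type_weight v (x + y) = type_weight v x + type_weight v y"
  by (simp add: type_weight_def distrib_left sum.distrib)

lemma type_weight_sum: "type_weight v (\<Sum>k\<in>K. x k) = (\<Sum>k\<in>K. type_weight v (x k))"
  by (induction K rule: infinite_finite_induct) (simp_all add: type_weight_add, simp_all add: type_weight_def)

lemma type_weight_ennreal:
  assumes "\<And>a. 0 \<le> u $ a"
  shows "type_weight (\<lambda>a. ennreal (u $ a)) x = ennreal (u \<bullet> real_vec x)"
  using assms
  by (simp add: type_weight_def inner_vec_def real_vec_def ennreal_of_nat_eq_real_of_nat
      sum_ennreal flip: ennreal_mult)

section \<open>Sources of randomness, the past and the lines of descent\<close>

context branching_with_immigration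
begin

definition source_var :: "source \<Rightarrow> 'w \<Rightarrow> nat ^ 2" where
  "source_var c = (case c of Initial \<Rightarrow> Z 0 | Offspring k n i l \<Rightarrow> \<xi> k n i l | Immigration k \<Rightarrow> I k)"

text \<open>Offspring vectors of generation \<open>m\<close> create generation \<open>m + 1\<close>,
  hence the strict bound \<open>m < n\<close>. \<open>Immigration 0\<close> lies outside the
  independent family.\<close>

definition past_sources :: "nat \<Rightarrow> source set" where
  "past_sources n = {Initial} \<union> {Offspring k m i l | k m i l. m < n} \<union> {Immigration k | k. 1 \<le> k \<and> k \<le> n}"

text \<open>Finer than the history of \<open>X\<close>: the totals \<open>X\<close> do not determine the sizes of the individual
  lines, on which the sources used in the next step depend.\<close>

definition past :: "nat \<Rightarrow> 'w measure" where
  "past n = vimage_algebra (space M) (\<lambda>\<omega>. \<lambda>c\<in>past_sources n. source_var c \<omega>)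
     (\<Pi>\<^sub>M c\<in>past_sources n. count_space UNIV)"

text \<open>The descendants in generation \<open>n\<close> of the \<open>k\<close>-th immigration, with the initial population as
  immigration \<open>0\<close>, in accordance with the indexing of \<open>\<xi>\<close>.\<close>

definition line :: "nat \<Rightarrow> nat \<Rightarrow> 'w \<Rightarrow> nat ^ 2" where
  "line k n = (if k = 0 then Z n else U k n)"

lemma indep_sources: "indep_vars (\<lambda>_. count_space UNIV) source_var (UNIV - {Immigration 0})"
  using independent unfolding source_var_def[abs_def] .

lemma space_past [simp]: "space (past n) = space M"
  by (simp add: past_def)

lemma source_var_measurable_past:
  "c \<in> past_sources n \<Longrightarrow> source_var c \<in> measurable (past n) (count_space UNIV)"
proof -
  assume c: "c \<in> past_sources n"
  have "(\<lambda>\<omega>. \<lambda>c\<in>past_sources n. source_var c \<omega>)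
      \<in> measurable (past n) (\<Pi>\<^sub>M c\<in>past_sources n. count_space UNIV)"
    unfolding past_def by (rule measurable_vimage_algebra1) (auto simp: space_PiM)
  from measurable_compose[OF this measurable_component_singleton[OF c]] c
  show ?thesis by simp
qed

text \<open>Minimality of \<open>past n\<close> among the sigma-algebras that make its sources
  measurable; it yields both the inclusion in \<open>M\<close> and monotonicity in
  \<open>n\<close>.\<close>

lemma sets_past_subset:
  assumes "\<And>c. c \<in> past_sources n \<Longrightarrow> source_var c \<in> measurable N (count_space UNIV)"
    and "space N = space M"
  shows "sets (past n) \<subseteq> sets N"
proof -
  have "(\<lambda>\<omega>. \<lambda>c\<in>past_sources n. source_var c \<omega>)
      \<in> measurable N (\<Pi>\<^sub>M c\<in>past_sources n. count_space UNIV)"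
    using assms(1) by (rule measurable_restrict)
  then show ?thesis
    unfolding past_def
    by (subst sets_vimage_algebra2) (auto simp: space_PiM measurable_sets assms(2)[symmetric])
qed

lemma source_var_measurable: "c \<noteq> Immigration 0 \<Longrightarrow> source_var c \<in> measurable M (count_space UNIV)"
  using indep_sources by (simp add: indep_vars_def2)

lemma sets_past: "sets (past n) \<subseteq> sets M"
  by (rule sets_past_subset) (auto simp: past_sources_def intro: source_var_measurable)

lemma past_mono: "m \<le> n \<Longrightarrow> sets (past m) \<subseteq> sets (past n)"
  by (rule sets_past_subset) (auto simp: past_sources_def intro!: source_var_measurable_past)

lemma measurable_past_mono:
  assumes "f \<in> measurable (past m) N" "m \<le> n"
  shows "f \<in> measurable (past n) N"
  using assms past_mono[OF assms(2)] by (auto simp: measurable_def)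

text \<open>The random population \<open>f\<close> takes countably many values, and for each fixed
  value the sum is a finite sum of sources of generation \<open>n\<close>.\<close>

lemma offspring_sum_measurable_past:
  assumes "f \<in> measurable (past n) (count_space UNIV)"
  shows "(\<lambda>\<omega>. \<Sum>i\<in>UNIV. \<Sum>l<f \<omega> $ i. \<xi> k n i l \<omega>) \<in> measurable (past (Suc n)) (count_space UNIV)"
proof (rule measurable_compose_countable
    [where g = f and f = "\<lambda>x \<omega>. \<Sum>i\<in>UNIV. \<Sum>l<x $ i. \<xi> k n i l \<omega>"])
  have "\<xi> k n i l \<in> measurable (past (Suc n)) (count_space UNIV)" for i l
    using source_var_measurable_past[of "Offspring k n i l" "Suc n"]
    by (simp add: past_sources_def source_var_def)
  then show "(\<lambda>\<omega>. \<Sum>i\<in>UNIV. \<Sum>l<x $ i. \<xi> k n i l \<omega>) \<in> measurable (past (Suc n)) (count_space UNIV)"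
    for x :: "nat ^ 2"
    by (intro measurable_count_space_sum)
qed (use assms in \<open>auto intro: measurable_past_mono\<close>)

lemma line_Suc:
  assumes "k \<le> n" "\<omega> \<in> space M"
  shows "line k (Suc n) \<omega> = (\<Sum>i\<in>UNIV. \<Sum>l<line k n \<omega> $ i. \<xi> k n i l \<omega>)"
  using assms Z_Suc[of \<omega> n] U_Suc[of k n \<omega>] by (auto simp: line_def)

lemma line_measurable_past: "k \<le> n \<Longrightarrow> line k n \<in> measurable (past n) (count_space UNIV)"
proof (induction n)
  case 0
  then show ?case
    using source_var_measurable_past[of Initial 0]
    by (simp add: past_sources_def source_var_def line_def)
next
  case (Suc n)
  show ?case
  proof (cases "k = Suc n")
    case True
    have "I (Suc n) \<in> measurable (past (Suc n)) (count_space UNIV)"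
      using source_var_measurable_past[of "Immigration (Suc n)" "Suc n"]
      by (simp add: past_sources_def source_var_def)
    then show ?thesis
      by (rule measurable_cong[THEN iffD1, rotated]) (simp add: True line_def U_start)
  next
    case False
    then have "k \<le> n" using Suc.prems by simp
    from offspring_sum_measurable_past[OF Suc.IH[OF this], of k] show ?thesis
      by (rule measurable_cong[THEN iffD1, rotated]) (simp add: line_Suc \<open>k \<le> n\<close>)
  qed
qed

lemma X_eq_sum_line:
  assumes "\<omega> \<in> space M"
  shows "X n \<omega> = (\<Sum>k\<le>n. line k n \<omega>)"
proof -
  have "{..n} = insert 0 {1..n}" by auto
  then show ?thesis using assms by (simp add: X_eq line_def)
qed

text \<open>Lines up to \<open>n\<close> reproduce, while line \<open>Suc n\<close> is only just
  starting and consists of the new immigrants.\<close>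

lemma X_Suc:
  assumes "\<omega> \<in> space M"
  shows "X (Suc n) \<omega> = (\<Sum>k\<le>n. \<Sum>i\<in>UNIV. \<Sum>l<line k n \<omega> $ i. \<xi> k n i l \<omega>) + I (Suc n) \<omega>"
  using assms by (simp add: X_eq_sum_line line_Suc) (simp add: line_def U_start)

lemma X_measurable_past:
  assumes "m \<le> n"
  shows "X m \<in> measurable (past n) (count_space UNIV)"
proof (rule measurable_past_mono[OF _ assms])
  have "(\<lambda>\<omega>. \<Sum>k\<le>m. line k m \<omega>) \<in> measurable (past m) (count_space UNIV)"
    by (intro measurable_count_space_sum line_measurable_past) simp
  then show "X m \<in> measurable (past m) (count_space UNIV)"
    by (rule measurable_cong[THEN iffD1, rotated]) (simp add: X_eq_sum_line)
qed

section \<open>Expected weight of the next generation on an event of the past\<close>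

lemma nn_integral_source:
  assumes "A \<in> sets (past n)" "c \<notin> past_sources n" "c \<noteq> Immigration 0"
    and "distr M (count_space UNIV) (source_var c) = N"
  shows "(\<integral>\<^sup>+\<omega>. indicator A \<omega> * g (source_var c \<omega>) \<partial>M) = emeasure M A * (\<integral>\<^sup>+x. g x \<partial>N)"
  by (rule nn_integral_indep_past[OF indep_sources])
    (use assms in \<open>auto simp: past_def past_sources_def\<close>)

text \<open>A Wald identity: whether the \<open>l\<close>-th particle of a line exists is decided by
  the past, independently of its offspring vector. Summing over \<open>l\<close> replaces each
  offspring weight by its expectation.\<close>

lemma nn_integral_type_weight_Suc:
  assumes A: "A \<in> sets (past n)"
  shows "(\<integral>\<^sup>+\<omega>. indicator A \<omega> * type_weight v (X (Suc n) \<omega>) \<partial>M)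
    = (\<integral>\<^sup>+\<omega>. indicator A \<omega> * type_weight (\<lambda>i. \<integral>\<^sup>+x. type_weight v x \<partial>measure_pmf (P i)) (X n \<omega>) \<partial>M)
      + emeasure M A * (\<integral>\<^sup>+x. type_weight v x \<partial>measure_pmf Q)"
proof -
  let ?c = "\<lambda>i. \<integral>\<^sup>+x. type_weight v x \<partial>measure_pmf (P i)"
  have AM[measurable]: "A \<in> sets M" using A sets_past by blast
  have line_past[measurable]: "line k n \<in> measurable (past n) (count_space UNIV)" if "k \<le> n" for k
    using that by (rule line_measurable_past)
  have [measurable]: "line k n \<in> measurable M (count_space UNIV)" if "k \<le> n" for k
    using line_past[OF that] sets_past[of n] by (auto simp: measurable_def)
  have [measurable]: "\<xi> k n i l \<in> measurable M (count_space UNIV)" for k i l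
    using source_var_measurable[of "Offspring k n i l"] by (simp add: source_var_def)
  have [measurable]: "I (Suc n) \<in> measurable M (count_space UNIV)"
    using source_var_measurable[of "Immigration (Suc n)"] by (simp add: source_var_def)
  \<comment> \<open>The part of \<open>A\<close> on which the \<open>l\<close>-th particle of type
    \<open>i\<close> in line \<open>k\<close> exists.\<close>
  define B where "B k i l = A \<inter> {\<omega>\<in>space M. l < line k n \<omega> $ i}" for k i l
  have B: "B k i l \<in> sets (past n)" if "k \<le> n" for k i l
  proof -
    have "{\<omega>\<in>space (past n). l < line k n \<omega> $ i} \<in> sets (past n)"
      using measurable_sets[OF line_past[OF that], of "{x. l < x $ i}"]
      by (simp add: vimage_def Int_def conj_commute)
    then show ?thesis using A by (auto simp: B_def)
  qed
  have BM[measurable]: "B k i l \<in> sets M" if "k \<le> n" for k i l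
    using B[OF that] sets_past by blast
  have B_sum: "(\<Sum>l. indicator (B k i l) \<omega> * h l) = indicator A \<omega> * (\<Sum>l<line k n \<omega> $ i. h l)"
    if "\<omega> \<in> space M" for k i \<omega> and h :: "nat \<Rightarrow> ennreal"
  proof -
    have "indicator (B k i l) \<omega> * h l = (if l < line k n \<omega> $ i then indicator A \<omega> * h l else 0)" for l
      using that by (auto simp: B_def indicator_def)
    then show ?thesis by (simp add: suminf_if_less sum_distrib_left)
  qed
  \<comment> \<open>The random sum is opened into a series over all \<open>l\<close>, independence
    is used for each term, and the series is closed again into the number of particles.\<close>
  have offspring: "(\<integral>\<^sup>+\<omega>. indicator A \<omega> * (\<Sum>l<line k n \<omega> $ i. type_weight v (\<xi> k n i l \<omega>)) \<partial>M)
      = (\<integral>\<^sup>+\<omega>. indicator A \<omega> * (?c i * of_nat (line k n \<omega> $ i)) \<partial>M)" if k: "k \<le> n" for k i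
  proof -
    note [measurable] = BM[OF k]
    have "(\<integral>\<^sup>+\<omega>. indicator A \<omega> * (\<Sum>l<line k n \<omega> $ i. type_weight v (\<xi> k n i l \<omega>)) \<partial>M)
        = (\<integral>\<^sup>+\<omega>. (\<Sum>l. indicator (B k i l) \<omega> * type_weight v (\<xi> k n i l \<omega>)) \<partial>M)"
      by (intro nn_integral_cong) (simp add: B_sum)
    also have "\<dots> = (\<Sum>l. \<integral>\<^sup>+\<omega>. indicator (B k i l) \<omega> * type_weight v (\<xi> k n i l \<omega>) \<partial>M)"
      by (intro nn_integral_suminf) measurable
    also have "\<dots> = (\<Sum>l. emeasure M (B k i l) * ?c i)"
      using nn_integral_source[OF B[OF k], of "Offspring k n i _" "measure_pmf (P i)"]
      by (simp add: source_var_def past_sources_def offspring_law)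
    also have "\<dots> = (\<Sum>l. \<integral>\<^sup>+\<omega>. indicator (B k i l) \<omega> * ?c i \<partial>M)"
      by (simp add: nn_integral_multc)
    also have "\<dots> = (\<integral>\<^sup>+\<omega>. (\<Sum>l. indicator (B k i l) \<omega> * ?c i) \<partial>M)"
      by (intro nn_integral_suminf[symmetric]) measurable
    also have "\<dots> = (\<integral>\<^sup>+\<omega>. indicator A \<omega> * (?c i * of_nat (line k n \<omega> $ i)) \<partial>M)"
      by (intro nn_integral_cong) (subst B_sum; simp add: mult.commute)
    finally show ?thesis .
  qed
  have [measurable]: "(\<lambda>\<omega>. \<Sum>l<line k n \<omega> $ i. type_weight v (\<xi> k n i l \<omega>)) \<in> borel_measurable M"
    if "k \<le> n" for k i
    by (rule measurable_compose_countable[where f = "\<lambda>m \<omega>. \<Sum>l<m. type_weight v (\<xi> k n i l \<omega>)"])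
      (use that in \<open>auto intro!: measurable_compose[of "line k n" M "count_space UNIV"]\<close>)
  have "(\<integral>\<^sup>+\<omega>. indicator A \<omega> * type_weight v (X (Suc n) \<omega>) \<partial>M)
      = (\<integral>\<^sup>+\<omega>. (\<Sum>k\<le>n. \<Sum>i\<in>UNIV. indicator A \<omega> * (\<Sum>l<line k n \<omega> $ i. type_weight v (\<xi> k n i l \<omega>)))
          + indicator A \<omega> * type_weight v (I (Suc n) \<omega>) \<partial>M)"
    by (intro nn_integral_cong)
      (simp add: X_Suc type_weight_add type_weight_sum distrib_left sum_distrib_left)
  also have "\<dots> = (\<Sum>k\<le>n. \<Sum>i\<in>UNIV.
        \<integral>\<^sup>+\<omega>. indicator A \<omega> * (\<Sum>l<line k n \<omega> $ i. type_weight v (\<xi> k n i l \<omega>)) \<partial>M)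
      + (\<integral>\<^sup>+\<omega>. indicator A \<omega> * type_weight v (I (Suc n) \<omega>) \<partial>M)"
  proof -
    have [measurable]: "(\<lambda>\<omega>. indicator A \<omega> * (\<Sum>l<line k n \<omega> $ i. type_weight v (\<xi> k n i l \<omega>)))
        \<in> borel_measurable M" if "k \<le> n" for k i
      using that by measurable
    have "(\<integral>\<^sup>+\<omega>. (\<Sum>k\<le>n. \<Sum>i\<in>UNIV. indicator A \<omega> * (\<Sum>l<line k n \<omega> $ i. type_weight v (\<xi> k n i l \<omega>))) \<partial>M)
        = (\<Sum>k\<le>n. \<integral>\<^sup>+\<omega>. (\<Sum>i\<in>UNIV. indicator A \<omega> * (\<Sum>l<line k n \<omega> $ i. type_weight v (\<xi> k n i l \<omega>))) \<partial>M)"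
      by (rule nn_integral_sum) simp
    also have "\<dots> = (\<Sum>k\<le>n. \<Sum>i\<in>UNIV. \<integral>\<^sup>+\<omega>. indicator A \<omega> * (\<Sum>l<line k n \<omega> $ i. type_weight v (\<xi> k n i l \<omega>)) \<partial>M)"
      by (intro sum.cong refl nn_integral_sum) simp
    finally show ?thesis
      by (subst nn_integral_add) simp_all
  qed
  also have "(\<integral>\<^sup>+\<omega>. indicator A \<omega> * type_weight v (I (Suc n) \<omega>) \<partial>M)
      = emeasure M A * (\<integral>\<^sup>+x. type_weight v x \<partial>measure_pmf Q)"
    using nn_integral_source[OF A, of "Immigration (Suc n)" "measure_pmf Q"]
    by (simp add: source_var_def past_sources_def immigration_law)
  also have "(\<Sum>k\<le>n. \<Sum>i\<in>UNIV.
        \<integral>\<^sup>+\<omega>. indicator A \<omega> * (\<Sum>l<line k n \<omega> $ i. type_weight v (\<xi> k n i l \<omega>)) \<partial>M)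
      = (\<Sum>k\<le>n. \<Sum>i\<in>UNIV. \<integral>\<^sup>+\<omega>. indicator A \<omega> * (?c i * of_nat (line k n \<omega> $ i)) \<partial>M)"
    by (intro sum.cong refl offspring) simp
  also have "\<dots> = (\<Sum>k\<le>n. \<integral>\<^sup>+\<omega>. (\<Sum>i\<in>UNIV. indicator A \<omega> * (?c i * of_nat (line k n \<omega> $ i))) \<partial>M)"
    by (intro sum.cong refl nn_integral_sum[symmetric]) simp
  also have "\<dots> = (\<integral>\<^sup>+\<omega>. (\<Sum>k\<le>n. \<Sum>i\<in>UNIV. indicator A \<omega> * (?c i * of_nat (line k n \<omega> $ i))) \<partial>M)"
    by (rule nn_integral_sum[symmetric]) simp
  also have "\<dots> = (\<integral>\<^sup>+\<omega>. indicator A \<omega> * type_weight ?c (X n \<omega>) \<partial>M)"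
  proof (rule nn_integral_cong)
    fix \<omega> assume \<omega>: "\<omega> \<in> space M"
    have "indicator A \<omega> * type_weight d (X n \<omega>)
        = (\<Sum>k\<le>n. \<Sum>i\<in>UNIV. indicator A \<omega> * (d i * of_nat (line k n \<omega> $ i)))" for d
      by (simp only: X_eq_sum_line[OF \<omega>] type_weight_sum sum_distrib_left)
        (simp only: type_weight_def sum_distrib_left)
    then show "(\<Sum>k\<le>n. \<Sum>i\<in>UNIV. indicator A \<omega> * (?c i * of_nat (line k n \<omega> $ i)))
        = indicator A \<omega> * type_weight ?c (X n \<omega>)" by (rule sym)
  qed
  finally show ?thesis .
qed

text \<open>Allows independence, which is formulated for the past of all sources, to be used on
  events of the history of \<open>X\<close>.\<close>

lemma history_subset_past: "sets (history M X n) \<subseteq> sets (past n)"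
proof -
  have "X k -` A \<inter> space M \<in> sets (past n)" if "k \<le> n" for k A
    using measurable_sets[OF X_measurable_past[OF that], of A] by simp
  then have "sigma_sets (space M) {X k -` A \<inter> space M | k A. k \<le> n} \<subseteq> sets (past n)"
    by (intro sets.sigma_sets_subset[of _ "past n", simplified]) auto
  then show ?thesis by (simp add: sets_history)
qed

end

text \<open>For the weights \<open>u\<close> the expected offspring weight of a particle of type
  \<open>i\<close> is the \<open>i\<close>-th entry of \<open>mean_matrix P *v u\<close>, so by the
  eigenvector equation reproduction multiplies weights by \<open>\<rho>\<close>.\<close>

lemma (in branching_with_immigration) nn_integral_weight_Suc:
  assumes mean_finite: "\<And>a b. offspring_mean P a b < \<infinity>"
    and u: "\<And>a. 0 \<le> u $ a" and u_eigen: "mean_matrix P *v u = \<rho> *s u" and \<rho>: "0 \<le> \<rho>"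
    and lam: "\<And>a. has_bochner_integral M (\<lambda>\<omega>. real (I 1 \<omega> $ a)) (lam $ a)"
    and A: "A \<in> sets (past n)"
  shows "(\<integral>\<^sup>+\<omega>. indicator A \<omega> * ennreal (u \<bullet> real_vec (X (Suc n) \<omega>)) \<partial>M)
    = ennreal \<rho> * (\<integral>\<^sup>+\<omega>. indicator A \<omega> * ennreal (u \<bullet> real_vec (X n \<omega>)) \<partial>M)
      + emeasure M A * ennreal (u \<bullet> lam)"
proof -
  let ?v = "\<lambda>a. ennreal (u $ a)"
  have lam0: "0 \<le> lam $ a" for a
  proof -
    have "lam $ a = (\<integral>\<omega>. real (I 1 \<omega> $ a) \<partial>M)" using lam by (simp add: has_bochner_integral_iff)
    then show ?thesis by simp
  qed
  have "(\<integral>\<^sup>+x. type_weight ?v x \<partial>measure_pmf (P i)) = ennreal \<rho> * ?v i" for i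
  proof -
    have "(\<integral>\<^sup>+x. type_weight ?v x \<partial>measure_pmf (P i))
        = (\<Sum>a\<in>UNIV. ?v a * (\<integral>\<^sup>+x. of_nat (x $ a) \<partial>measure_pmf (P i)))"
      by (simp add: type_weight_def nn_integral_sum nn_integral_cmult)
    also have "\<dots> = (\<Sum>a\<in>UNIV. ennreal (mean_matrix P $ i $ a * u $ a))"
      using u mean_matrix_nn_integral[OF mean_finite]
      by (simp add: ennreal_mult mult.commute)
    also have "\<dots> = ennreal ((mean_matrix P *v u) $ i)"
      using u mean_matrix_nn_integral(2)[OF mean_finite]
      by (simp add: matrix_vector_mult_def sum_ennreal)
    also have "\<dots> = ennreal \<rho> * ?v i"
      using u \<rho> by (simp add: u_eigen ennreal_mult)
    finally show ?thesis .
  qed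
  then have offspring: "type_weight (\<lambda>i. \<integral>\<^sup>+x. type_weight ?v x \<partial>measure_pmf (P i)) x
      = ennreal \<rho> * type_weight ?v x" for x
    by (simp add: type_weight_def sum_distrib_left mult.assoc)
  have [measurable]: "I (Suc 0) \<in> measurable M (count_space UNIV)"
    using source_var_measurable[of "Immigration (Suc 0)"] by (simp add: source_var_def)
  \<comment> \<open>All immigration vectors have law \<open>Q\<close>, so its mean can be read off
    from \<open>I 1\<close>.\<close>
  have "(\<integral>\<^sup>+x. type_weight ?v x \<partial>measure_pmf Q) = (\<integral>\<^sup>+\<omega>. type_weight ?v (I 1 \<omega>) \<partial>M)"
    by (simp add: nn_integral_distr flip: immigration_law[of 1])
  also have "\<dots> = (\<Sum>a\<in>UNIV. ?v a * (\<integral>\<^sup>+\<omega>. of_nat (I 1 \<omega> $ a) \<partial>M))"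
    by (simp add: type_weight_def nn_integral_sum nn_integral_cmult)
  also have "\<dots> = (\<Sum>a\<in>UNIV. ?v a * ennreal (lam $ a))"
    using lam by (simp add: ennreal_of_nat_eq_real_of_nat nn_integral_eq_integral
        has_bochner_integral_iff)
  also have "\<dots> = ennreal (u \<bullet> lam)"
    using u lam0 by (simp add: inner_vec_def sum_ennreal flip: ennreal_mult)
  finally have immigration: "(\<integral>\<^sup>+x. type_weight ?v x \<partial>measure_pmf Q) = ennreal (u \<bullet> lam)" .
  have [measurable]: "X n \<in> measurable M (count_space UNIV)"
    using X_measurable_past[of n n] sets_past[of n] by (auto simp: measurable_def)
  have [measurable]: "A \<in> sets M" using A sets_past by blast
  show ?thesis
    using nn_integral_type_weight_Suc[OF A, of ?v] 
    unfolding offspring immigration unfolding type_weight_ennreal[OF u]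
    by (simp add: mult.left_commute[of _ "ennreal \<rho>"] nn_integral_cmult)
qed

section \<open>Martingale property, lower bound and limit of the normalized process\<close>

theorem proposition3p4:
  fixes M :: "'w measure"
    and P :: "2 \<Rightarrow> (nat ^ 2) pmf" and Q :: "(nat ^ 2) pmf"
    and \<xi> :: "nat \<Rightarrow> nat \<Rightarrow> 2 \<Rightarrow> nat \<Rightarrow> 'w \<Rightarrow> nat ^ 2"
    and I :: "nat \<Rightarrow> 'w \<Rightarrow> nat ^ 2"
    and Z :: "nat \<Rightarrow> 'w \<Rightarrow> nat ^ 2"
    and U :: "nat \<Rightarrow> nat \<Rightarrow> 'w \<Rightarrow> nat ^ 2"
    and X :: "nat \<Rightarrow> 'w \<Rightarrow> nat ^ 2"
    and \<rho> :: real and u lam :: "real ^ 2" and i :: 2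
  assumes process: "branching_with_immigration M P Q \<xi> I Z U X"
    and start: "AE \<omega> in M. X 0 \<omega> = axis i 1"
    and f_zero: "offspring_gf P 0 = 0"
    and mean_finite: "\<forall>a b. offspring_mean P a b < \<infinity>"
    and pos_reg: "positively_regular (mean_matrix P)"
    and rho_max: "maximal_eigenvalue (mean_matrix P) \<rho>"
    and rho_gt_1: "\<rho> > 1"
    and u_pos: "\<forall>a. 0 < u $ a"
    and u_eigen: "mean_matrix P *v u = \<rho> *s u"
    and u_norm: "u \<bullet> 1 = 1"
    and lam: "\<forall>n\<ge>1. \<forall>a. has_bochner_integral M (\<lambda>\<omega>. real (I n \<omega> $ a)) (lam $ a)"
  shows "martingale M (history M X) (normalized \<rho> u lam X)
    \<and> (\<exists>Y \<in> borel_measurable M.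
         AE \<omega> in M. (\<lambda>n. normalized \<rho> u lam X n \<omega>) \<longlonglongrightarrow> Y \<omega>)"
proof -
  interpret branching_with_immigration M P Q \<xi> I Z U X by (rule process)
  let ?F = "history M X" and ?Y = "normalized \<rho> u lam X"
  define W where "W n \<omega> = u \<bullet> real_vec (X n \<omega>)" for n \<omega>
  have u: "0 \<le> u $ a" for a using u_pos by (simp add: less_imp_le)
  have W_nonneg: "0 \<le> W n \<omega>" for n \<omega>
    using u by (simp add: W_def inner_vec_def real_vec_def sum_nonneg)
  have lam_nonneg: "0 \<le> lam $ a" for a
  proof -
    have "lam $ a = (\<integral>\<omega>. real (I 1 \<omega> $ a) \<partial>M)" using lam by (simp add: has_bochner_integral_iff)
    then show ?thesis by simp
  qed
  have ulam: "0 \<le> u \<bullet> lam" using u lam_nonneg by (simp add: inner_vec_def sum_nonneg)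
  have sub: "subalgebra M (?F n)" for n
    using history_subset_past[of n] sets_past[of n] by (simp add: subalgebra_def)
  have W_hist: "W n \<in> borel_measurable (?F n)" for n
    unfolding W_def[abs_def] by (rule measurable_compose[OF measurable_history]) simp
  have [measurable]: "W n \<in> borel_measurable M" for n
    by (rule measurable_from_subalg[OF sub W_hist])
  have step: "(\<integral>\<^sup>+\<omega>. indicator A \<omega> * ennreal (W (Suc n) \<omega>) \<partial>M)
    = ennreal \<rho> * (\<integral>\<^sup>+\<omega>. indicator A \<omega> * ennreal (W n \<omega>) \<partial>M) + emeasure M A * ennreal (u \<bullet> lam)"
    if "A \<in> sets (past n)" for n A
    unfolding W_def using that mean_finite u u_eigen rho_gt_1 lam
    by (intro nn_integral_weight_Suc) auto
  \<comment> \<open>Integrability comes from the same recursion, applied to the whole space and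
    started at the deterministic initial population.\<close>
  have "(\<integral>\<^sup>+\<omega>. ennreal (W n \<omega>) \<partial>M) < \<infinity>" for n
  proof (induction n)
    case 0
    have "(\<integral>\<^sup>+\<omega>. ennreal (W 0 \<omega>) \<partial>M) = (\<integral>\<^sup>+\<omega>. ennreal (u \<bullet> real_vec (axis i 1)) \<partial>M)"
      using start by (intro nn_integral_cong_AE) (auto simp: W_def)
    then show ?case by (simp add: emeasure_space_1)
  next
    case (Suc n)
    have "(\<integral>\<^sup>+\<omega>. indicator (space M) \<omega> * ennreal (W k \<omega>) \<partial>M) = (\<integral>\<^sup>+\<omega>. ennreal (W k \<omega>) \<partial>M)" for k
      by (intro nn_integral_cong) simp
    then have "(\<integral>\<^sup>+\<omega>. ennreal (W (Suc n) \<omega>) \<partial>M)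
        = ennreal \<rho> * (\<integral>\<^sup>+\<omega>. ennreal (W n \<omega>) \<partial>M) + ennreal (u \<bullet> lam)"
      using step[of "space M" n] sets.top[of "past n"] by (simp add: emeasure_space_1)
    with Suc show ?case by (simp add: ennreal_mult_less_top)
  qed
  then have W_int: "integrable M (W n)" for n
    by (intro integrableI_nonneg) (auto simp: W_nonneg)
  have AM: "A \<in> sets M" if "A \<in> sets (?F n)" for A n using that sub by (auto simp: subalgebra_def)
  have W_step: "(\<integral>\<omega>\<in>A. W (Suc n) \<omega> \<partial>M) = \<rho> * (\<integral>\<omega>\<in>A. W n \<omega> \<partial>M) + measure M A * (u \<bullet> lam)"
    if A: "A \<in> sets (?F n)" for A n
  proof -
    have nn: "(\<integral>\<^sup>+\<omega>. indicator A \<omega> * ennreal (W k \<omega>) \<partial>M) = ennreal (\<integral>\<omega>\<in>A. W k \<omega> \<partial>M)"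
      "0 \<le> (\<integral>\<omega>\<in>A. W k \<omega> \<partial>M)" for k
    proof -
      have "(\<integral>\<^sup>+\<omega>. indicator A \<omega> * ennreal (W k \<omega>) \<partial>M) = (\<integral>\<^sup>+\<omega>. ennreal (indicator A \<omega> *\<^sub>R W k \<omega>) \<partial>M)"
        by (intro nn_integral_cong) (simp add: indicator_def)
      also have "\<dots> = ennreal (\<integral>\<omega>\<in>A. W k \<omega> \<partial>M)"
        unfolding set_lebesgue_integral_def
        by (intro nn_integral_eq_integral integrable_mult_indicator AM[OF A] W_int)
          (simp add: W_nonneg)
      finally show "(\<integral>\<^sup>+\<omega>. indicator A \<omega> * ennreal (W k \<omega>) \<partial>M) = ennreal (\<integral>\<omega>\<in>A. W k \<omega> \<partial>M)" .
      show "0 \<le> (\<integral>\<omega>\<in>A. W k \<omega> \<partial>M)"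
        unfolding set_lebesgue_integral_def by (simp add: W_nonneg)
    qed
    have "A \<in> sets (past n)" using A history_subset_past by blast
    from step[OF this] have "ennreal (\<integral>\<omega>\<in>A. W (Suc n) \<omega> \<partial>M)
        = ennreal (\<rho> * (\<integral>\<omega>\<in>A. W n \<omega> \<partial>M) + measure M A * (u \<bullet> lam))"
      using rho_gt_1 ulam nn(2)
      by (simp add: nn(1) emeasure_eq_measure ennreal_mult ennreal_plus)
    then show ?thesis
      using rho_gt_1 ulam nn(2) by (subst (asm) ennreal_inj) auto
  qed
  \<comment> \<open>The geometric sum of \<open>\<rho> ^ j * (u \<bullet> lam)\<close> over
    \<open>j \<le> n\<close>; it obeys the same recursion as the expectation of
    \<open>W\<close>.\<close>
  define c where "c n = (\<rho> ^ (n + 1) - 1) / (\<rho> - 1) * (u \<bullet> lam)" for n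
  have Y: "?Y n \<omega> = inverse (\<rho> ^ n) * (W n \<omega> - c n)" for n \<omega>
    by (simp add: normalized_def W_def c_def)
  have c_Suc: "c (Suc n) = \<rho> * c n + u \<bullet> lam" for n
    using rho_gt_1 by (simp add: c_def field_simps)
  have Y_int: "integrable M (?Y n)" for n
    unfolding Y using W_int by simp
  have Y_hist: "?Y n \<in> borel_measurable (?F n)" for n
    unfolding Y[abs_def] using W_hist[of n] by measurable
  \<comment> \<open>In \<open>W - c\<close> the immigration terms cancel and a factor
    \<open>\<rho>\<close> remains, which the normalization absorbs.\<close>
  have Y_step: "(\<integral>\<omega>\<in>A. ?Y (Suc n) \<omega> \<partial>M) = (\<integral>\<omega>\<in>A. ?Y n \<omega> \<partial>M)" if A: "A \<in> sets (?F n)" for A n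
  proof -
    have Y_set_int: "(\<integral>\<omega>\<in>A. ?Y k \<omega> \<partial>M) = inverse (\<rho> ^ k) * ((\<integral>\<omega>\<in>A. W k \<omega> \<partial>M) - measure M A * c k)" for k
    proof -
      have "set_integrable M A (W k)"
        unfolding set_integrable_def by (intro integrable_mult_indicator AM[OF A] W_int)
      moreover have "set_integrable M A (\<lambda>_. c k)"
        unfolding set_integrable_def by (intro integrable_mult_indicator AM[OF A]) simp
      ultimately show ?thesis
        using AM[OF A] by (simp add: Y set_integral_diff) (simp add: set_lebesgue_integral_def)
    qed
    show ?thesis
      using rho_gt_1 by (simp only: Y_set_int W_step[OF A] c_Suc) (simp add: field_simps)
  qed
  have mart: "martingale M ?F ?Y"
    unfolding martingale_def
  proof (intro conjI allI)
    fix n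
    interpret sigma_finite_subalgebra M "?F n"
      by (intro finite_measure_subalgebra_is_sigma_finite finite_measure_subalgebra.intro
          finite_measure_subalgebra_axioms.intro finite_measure_axioms sub)
    show "AE \<omega> in M. real_cond_exp M (?F n) (?Y (Suc n)) \<omega> = ?Y n \<omega>"
      by (rule real_cond_exp_charact) (simp_all add: Y_step Y_int Y_hist)
  qed (simp_all add: filtration_history sub Y_int Y_hist)
  \<comment> \<open>As \<open>W\<close> is nonnegative, only the normalized compensator matters, and
    \<open>\<rho> ^ (n + 1) - 1 \<le> \<rho> ^ (n + 1)\<close> bounds it.\<close>
  have "- (\<rho> / (\<rho> - 1) * (u \<bullet> lam)) \<le> ?Y n \<omega>" for n \<omega>
  proof -
    have "inverse (\<rho> ^ n) * c n \<le> \<rho> / (\<rho> - 1) * (u \<bullet> lam)"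
    proof -
      have "inverse (\<rho> ^ n) * ((\<rho> ^ (n + 1) - 1) / (\<rho> - 1)) \<le> \<rho> / (\<rho> - 1)"
        using rho_gt_1 by (simp add: field_simps)
      from mult_right_mono[OF this ulam] show ?thesis by (simp add: c_def mult.assoc)
    qed
    moreover have "0 \<le> inverse (\<rho> ^ n) * W n \<omega>"
      using rho_gt_1 W_nonneg by simp
    ultimately show ?thesis by (simp add: Y right_diff_distrib)
  qed
  then have conv: "AE \<omega> in M. convergent (\<lambda>n. ?Y n \<omega>)"
    by (rule martingale_convergent[OF mart])
  \<comment> \<open>The witness \<open>Y\<close> is \<open>lim\<close>, which has some value even
    where the sequence diverges and is measurable on the whole space.\<close>
  have "(\<lambda>\<omega>. lim (\<lambda>n. ?Y n \<omega>)) \<in> borel_measurable M"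
    by (rule borel_measurable_lim_metric) (rule borel_measurable_integrable[OF Y_int])
  moreover have "AE \<omega> in M. (\<lambda>n. ?Y n \<omega>) \<longlonglongrightarrow> lim (\<lambda>n. ?Y n \<omega>)"
    using conv by eventually_elim (simp add: convergent_LIMSEQ_iff)
  ultimately show ?thesis
    using mart by (intro conjI bexI[of _ "\<lambda>\<omega>. lim (\<lambda>n. ?Y n \<omega>)"])
qed

end
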